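(* Let $\omega_i=(\alpha_i,\varepsilon_{i1},\varepsilon_{i2},\mu_i,\eta_{i1},\eta_{i2})$. Suppose that $P(\nu_i>c)\in(0,1)$ for some $c\in\mathbb{R}$ and that $\nu_i$ is independent of $(\alpha_i,\varepsilon_{i1},\varepsilon_{i2},\mu_i,\eta_{i1},\eta_{i2})$. Suppose further that either $P(E[\dot Y_{i2}(0)-\dot Y_{i1}(0)\mid\omega_i]>0)<1$ or $P(E[\dot Y_{i2}(0)-\dot Y_{i1}(0)\mid\omega_i]<0)<1$. Then parallel trends, $E[Y_{i2}(0)-Y_{i1}(0)\mid G_i=1]=E[Y_{i2}(0)-Y_{i1}(0)\mid G_i=0]$, holds for all $g\in\mathcal{G}_\omega$ such that $G_i=g(\omega_i,\nu_i)$ satisfies $P(G_i=1)\in(0,1)$ if and only if $\dot Y_{i1}(0)=\dot Y_{i2}(0)$ almost surely. Likewise, let instead $\omega_i=(\alpha_i,\varepsilon_{i1},\varepsilon_{i2})$, and suppose that $P(\nu_i>c)\in(0,1)$ for some $c\in\mathbb{R}$, that $\nu_i$ is independent of $(\alpha_i,\varepsilon_{i1},\varepsilon_{i2},\mu_i,\eta_{i1},\eta_{i2})$, and that either $P(E[\dot Y_{i2}(0)-\dot Y_{i1}(0)\mid\alpha_i,\varepsilon_{i1},\varepsilon_{i2}]>0)<1$ or $P(E[\dot Y_{i2}(0)-\dot Y_{i1}(0)\mid\alpha_i,\varepsilon_{i1},\varepsilon_{i2}]<0)<1$. Then parallel trends, $E[Y_{i2}(0)-Y_{i1}(0)\mid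 G_i=1]=E[Y_{i2}(0)-Y_{i1}(0)\mid G_i=0]$, holds for all $g\in\mathcal{G}_\omega$ (with $\omega_i=(\alpha_i,\varepsilon_{i1},\varepsilon_{i2})$) such that $G_i=g(\omega_i,\nu_i)$ satisfies $P(G_i=1)\in(0,1)$ if and only if $\dot Y_{i1}(0)=\dot Y_{i2}(0)$ almost surely.
   Context: Units are indexed by $i$ (i.i.d. across $i$; all statements are about a generic unit $i$) and periods by $t\in\{1,2\}$. The unobservables $\alpha_i,\varepsilon_{i1},\varepsilon_{i2}$ are finite-dimensional random vectors, $\mu_i,\eta_{i1},\eta_{i2}$ are additional random vectors, and $\nu_i$ is a scalar random variable. The untreated potential outcomes are real-valued and given by $Y_{it}(0)=\xi_t(\alpha_i,\varepsilon_{it})$, $t=1,2$, for arbitrary (measurable) functions $\xi_t$. All relevant moments are assumed to exist (in particular $E|Y_{it}(0)|<\infty$). Notation: $\dot Y_{it}(0)=Y_{it}(0)-E[Y_{it}(0)]$. Let $\mathcal{O}$ and $\mathcal{V}$ be the supports of $\omega_i$ and $\nu_i$; $\mathcal{G}_\omega$ is the class of all (measurable) functions $g:\mathcal{O}\times\mathcal{V}\to\{0,1\}$, called selection mechanisms, and the treatment-group indicator generated by $g$ is $G_i=g(\omega_i,\nu_i)$. The distribution of the unobservables is held fixed as $g$ varies. *)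

theory Defs
  imports "HOL-Probability.Probability"
begin

text \<open>The (topological) support of the distribution of a random vector.\<close>

definition rv_support :: "'w measure \<Rightarrow> ('w \<Rightarrow> 'b::topological_space) \<Rightarrow> 'b set" where
  "rv_support M X = {x. \<forall>U. open U \<and> x \<in> U \<longrightarrow> \<P>(w in M. X w \<in> U) > 0}"

definition demeaned :: "'w measure \<Rightarrow> ('w \<Rightarrow> real) \<Rightarrow> 'w \<Rightarrow> real" where
  "demeaned M Y = (\<lambda>w. Y w - integral\<^sup>L M Y)"

text \<open>Conditional expectation given a random vector \<open>X\<close>, that is, given the
  \<open>\<sigma>\<close>-algebra generated by \<open>X\<close>.\<close>

definition cond_exp_given ::
  "'w measure \<Rightarrow> ('w \<Rightarrow> 'b::topological_space) \<Rightarrow> ('w \<Rightarrow> real) \<Rightarrow> 'w \<Rightarrow> real" where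
  "cond_exp_given M X Y = real_cond_exp M (vimage_algebra (space M) X borel) Y"

text \<open>Independence of two random vectors, as independence of their generated
  \<open>\<sigma>\<close>-algebras. The library's \<open>indep_var\<close> is the same notion, but restricted to random
  variables with values in a common type.\<close>

definition rv_indep ::
  "'w measure \<Rightarrow> ('w \<Rightarrow> 'b::topological_space) \<Rightarrow> ('w \<Rightarrow> 'c::topological_space) \<Rightarrow> bool" where
  "rv_indep M X Y \<longleftrightarrow>
     prob_space.indep_set M (sets (vimage_algebra (space M) X borel))
       (sets (vimage_algebra (space M) Y borel))"

text \<open>Elementary conditional expectation given an event \<open>A\<close> of positive probability:
  \<open>uniform_measure M A\<close> is the conditional measure \<open>B \<mapsto> P(A \<inter> B) / P(A)\<close>.\<close>

definition cond_exp_event :: "'w measure \<Rightarrow> 'w set \<Rightarrow> ('w \<Rightarrow> real) \<Rightarrow> real" where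
  "cond_exp_event M A Y = integral\<^sup>L (uniform_measure M A) Y"

text \<open>Selection mechanisms are the measurable functions from the product of the supports to
  \<open>{0, 1}\<close>. A function with that domain is represented by an extensional one, which is constantly
  \<open>undefined\<close> elsewhere. Since \<open>(\<omega>, \<nu>)\<close> lies in the product of the supports almost
  surely, this only matters on a null set, where extensionality keeps the group indicator
  measurable.\<close>

definition selection_mechanisms ::
  "'w measure \<Rightarrow> ('w \<Rightarrow> 'b::topological_space) \<Rightarrow> ('w \<Rightarrow> real) \<Rightarrow> ('b \<times> real \<Rightarrow> nat) set" where
  "selection_mechanisms M \<omega> \<nu> =
     measurable (restrict_space borel (rv_support M \<omega> \<times> rv_support M \<nu>)) (count_space {0, 1})
     \<inter> extensional (rv_support M \<omega> \<times> rv_support M \<nu>)"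

definition parallel_trends ::
  "'w measure \<Rightarrow> ('w \<Rightarrow> real) \<Rightarrow> ('w \<Rightarrow> real) \<Rightarrow> ('w \<Rightarrow> nat) \<Rightarrow> bool" where
  "parallel_trends M Y1 Y2 G \<longleftrightarrow>
     cond_exp_event M {w \<in> space M. G w = 1} (\<lambda>w. Y2 w - Y1 w) =
     cond_exp_event M {w \<in> space M. G w = 0} (\<lambda>w. Y2 w - Y1 w)"

definition parallel_trends_all ::
  "'w measure \<Rightarrow> ('w \<Rightarrow> real) \<Rightarrow> ('w \<Rightarrow> real) \<Rightarrow> ('w \<Rightarrow> 'b::topological_space) \<Rightarrow> ('w \<Rightarrow> real) \<Rightarrow> bool"
  where
  "parallel_trends_all M Y1 Y2 \<omega> \<nu> \<longleftrightarrow>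
     (\<forall>g \<in> selection_mechanisms M \<omega> \<nu>.
        \<P>(w in M. g (\<omega> w, \<nu> w) = 1) \<in> {0<..<1} \<longrightarrow>
        parallel_trends M Y1 Y2 (\<lambda>w. g (\<omega> w, \<nu> w)))"

end

theory Submission
  imports Defs
begin

text \<open>Both outcomes are functions of \<open>\<omega>\<close>, hence so is \<open>D = Y2 - Y1\<close>, and selecting exactly the units
  with \<open>D > E[D]\<close> is admissible. As \<open>D\<close> has the same mean in both groups, that mean is \<open>E[D]\<close>, so
  the positive part of \<open>D - E[D]\<close> integrates to zero; since \<open>D - E[D]\<close> is centred, it vanishes
  almost surely.\<close>

text \<open>The complement is the union of the open sets that \<open>X\<close> hits with probability
  zero. Closedness makes the product of two supports a Borel set.\<close>

lemma closed_rv_support: "closed (rv_support M X)"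
proof -
  have "- rv_support M X = \<Union>{U. open U \<and> \<not> \<P>(w in M. X w \<in> U) > 0}"
    unfolding rv_support_def by blast
  then show ?thesis
    unfolding closed_def by auto
qed

context prob_space
begin

text \<open>The complement of the support may be a union of uncountably many null open sets. Second
  countability cuts it down to the countably many null members \<open>N\<close> of a basis: if
  \<open>X w\<close> avoids all of these, each neighbourhood of \<open>X w\<close> contains a basic
  one of positive probability.\<close>

lemma AE_in_rv_support:
  fixes X :: "'a \<Rightarrow> 'b::second_countable_topology"
  assumes [measurable]: "X \<in> borel_measurable M"
  shows "AE w in M. X w \<in> rv_support M X"
proof -
  obtain B :: "'b set set" where B: "countable B" "topological_basis B"
    using ex_countable_basis by blast
  define N where "N = {U \<in> B. \<P>(w in M. X w \<in> U) = 0}"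
  have "AE w in M. \<forall>U\<in>N. X w \<notin> U"
  proof (rule AE_ball_countable')
    show "countable N"
      using B(1) unfolding N_def by simp
    fix U assume U: "U \<in> N"
    then have "open U"
      using B(2) topological_basis_open unfolding N_def by blast
    then have [measurable]: "U \<in> sets borel"
      by simp
    have "{w \<in> space M. X w \<in> U} \<in> sets M"
      by measurable
    with U show "AE w in M. X w \<notin> U"
      unfolding N_def by (subst (asm) mem_Collect_eq) (auto simp: prob_Collect_eq_0)
  qed
  then show ?thesis
  proof eventually_elim
    case (elim w)
    show ?case
      unfolding rv_support_def
    proof (safe)
      fix U assume "open U" "X w \<in> U"
      then obtain V where V: "V \<in> B" "X w \<in> V" "V \<subseteq> U"
        using topological_basisE[OF B(2)] by metis
      then have "0 < \<P>(w in M. X w \<in> V)"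
        using elim unfolding N_def zero_less_measure_iff by blast
      also have "\<dots> \<le> \<P>(w in M. X w \<in> U)"
        using V(3) borel_open[OF \<open>open U\<close>]
        by (intro finite_measure_mono) (auto intro!: measurable_sets_Collect[OF assms])
      finally show "0 < \<P>(w in M. X w \<in> U)" .
    qed
  qed
qed

text \<open>Conditioning on \<open>A\<close> is the change of measure with density
  \<open>indicator A / prob A\<close>; the quotient form makes the group means comparable.\<close>

lemma cond_exp_event_eq:
  assumes "A \<in> events" "f \<in> borel_measurable M" "prob A \<noteq> 0"
  shows "cond_exp_event M A f = (\<integral>w. indicator A w * f w \<partial>M) / prob A"
proof -
  have pos: "0 < prob A"
    using assms(3) by (simp add: zero_less_measure_iff)
  have "uniform_measure M A = density M (\<lambda>w. ennreal (indicator A w / prob A))"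
    unfolding uniform_measure_def using pos
    by (intro arg_cong[where f="density M"] ext)
       (auto simp: emeasure_eq_measure divide_ennreal indicator_def ennreal_1[symmetric] simp del: ennreal_1)
  then show ?thesis
    unfolding cond_exp_event_def using assms by (simp add: integral_real_density)
qed

text \<open>Measurability of \<open>g\<close> is known only on the product of supports; on the rest
  \<open>g\<close> is constant, so its level sets are Borel in the whole space and the treatment
  groups are events.\<close>

lemma sets_selection_mechanism:
  fixes \<omega> :: "'a \<Rightarrow> 'b::second_countable_topology"
  assumes g: "g \<in> selection_mechanisms M \<omega> \<nu>" and i: "i \<in> {0, 1}"
  shows "{p. g p = i} \<in> sets borel"
proof -
  define S where "S = rv_support M \<omega> \<times> rv_support M \<nu>"
  have S: "S \<in> sets borel"
    unfolding S_def by (intro borel_closed closed_Times closed_rv_support)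
  have "g -` {i} \<inter> space (restrict_space borel S) \<in> sets (restrict_space borel S)"
    using g i unfolding selection_mechanisms_def S_def
    by (intro measurable_sets[where A="count_space {0, 1}"]) auto
  then have "g -` {i} \<inter> S \<in> sets borel"
    using S by (simp add: sets_restrict_space_iff space_restrict_space)
  \<comment> \<open>\<open>undefined\<close> is a fixed but unspecified number that may coincide
    with \<open>i\<close>, so off \<open>S\<close> the level set is everything or nothing.\<close>
  moreover have "p \<in> {p. g p = i} \<longleftrightarrow> p \<in> (g -` {i} \<inter> S) \<union> (if undefined = i then - S else {})" for p
    using extensional_arb[of g S p] g unfolding selection_mechanisms_def S_def[symmetric]
    by (cases "p \<in> S") auto
  then have "{p. g p = i} = (g -` {i} \<inter> S) \<union> (if undefined = i then - S else {})"
    by blast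
  ultimately show ?thesis
    using S by auto
qed

text \<open>Almost surely both vectors lie in their supports, where \<open>g\<close> is binary.
  Hence the groups 0 and 1 partition the sample space up to a null set.\<close>

lemma AE_selection_mechanism:
  fixes \<omega> :: "'a \<Rightarrow> 'b::second_countable_topology"
  assumes "g \<in> selection_mechanisms M \<omega> \<nu>"
    and "\<omega> \<in> borel_measurable M" "\<nu> \<in> borel_measurable M"
  shows "AE w in M. g (\<omega> w, \<nu> w) \<in> {0, 1}"
  using AE_in_rv_support[OF assms(2)] AE_in_rv_support[OF assms(3)]
proof eventually_elim
  case (elim w)
  then have p: "(\<omega> w, \<nu> w) \<in> space (restrict_space borel (rv_support M \<omega> \<times> rv_support M \<nu>))"
    by (simp add: space_restrict_space)
  have "g (\<omega> w, \<nu> w) \<in> space (count_space {0, 1})"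
    using assms(1) unfolding selection_mechanisms_def by (rule measurable_space[OF IntD1 p])
  then show ?case
    by (simp only: space_count_space)
qed

text \<open>Equal means in two complementary groups must both equal the overall mean
  \<open>c\<close>. So the comparison of two conditional means becomes one linear condition on the
  treated group: the centred difference integrates to zero there.\<close>

lemma parallel_trends_iff:
  fixes G :: "'a \<Rightarrow> nat"
  assumes Y: "integrable M Y1" "integrable M Y2"
    and ev: "{w \<in> space M. G w = 1} \<in> events" "{w \<in> space M. G w = 0} \<in> events"
    and G: "AE w in M. G w \<in> {0, 1}"
    and p: "\<P>(w in M. G w = 1) \<in> {0<..<1}"
  shows "parallel_trends M Y1 Y2 G \<longleftrightarrow>
    (\<integral>w. indicator {w \<in> space M. G w = 1} w * (demeaned M Y2 w - demeaned M Y1 w) \<partial>M) = 0"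
proof -
  define A B f c where "A = {w \<in> space M. G w = 1}" and "B = {w \<in> space M. G w = 0}"
    and "f = (\<lambda>w. Y2 w - Y1 w)" and "c = expectation Y2 - expectation Y1"
  note [measurable] = ev[folded A_def B_def]
  have f: "integrable M f" "expectation f = c"
    using Y unfolding f_def c_def by simp_all
  have iA: "integrable M (\<lambda>w. indicator A w * f w)" and iB: "integrable M (\<lambda>w. indicator B w * f w)"
    using f(1) by (auto intro!: integrable_real_mult_indicator simp: mult.commute)
  have AB: "AE w in M. indicator A w + indicator B w = (1::real)"
    using G AE_space by eventually_elim (auto simp: A_def B_def)
  have "expectation (\<lambda>w. indicator A w + indicator B w) = (1::real)"
    using integral_cong_AE[OF _ _ AB] prob_space by simp
  then have pB: "prob B = 1 - prob A"
    by (subst (asm) Bochner_Integration.integral_add) (auto simp: less_top[symmetric])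
  define a b where "a = (\<integral>w. indicator A w * f w \<partial>M)" and "b = (\<integral>w. indicator B w * f w \<partial>M)"
  have "a + b = (\<integral>w. indicator A w * f w + indicator B w * f w \<partial>M)"
    unfolding a_def b_def using iA iB by simp
  also have "\<dots> = c"
    unfolding f(2)[symmetric] using AB f(1)
    by (intro integral_cong_AE) (auto simp: distrib_right[symmetric])
  finally have ab: "a + b = c" .
  have pA: "0 < prob A" "prob A < 1"
    using p unfolding A_def by auto
  have "parallel_trends M Y1 Y2 G \<longleftrightarrow> a / prob A = b / prob B"
    unfolding parallel_trends_def A_def[symmetric] B_def[symmetric] f_def[symmetric]
    using pA pB f(1) by (simp add: cond_exp_event_eq a_def b_def)
  also have "\<dots> \<longleftrightarrow> a * (1 - prob A) = b * prob A"
    using pA by (simp add: pB frac_eq_eq)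
  \<comment> \<open>With \<open>c = a + b\<close>, the products \<open>a * prob A\<close> on both
    sides merge with \<open>b * prob A\<close> into \<open>c * prob A\<close>.\<close>
  also have "\<dots> \<longleftrightarrow> a - c * prob A = 0"
    unfolding ab[symmetric] by (auto simp: algebra_simps)
  also have "a - c * prob A = (\<integral>w. indicator A w * f w - c * indicator A w \<partial>M)"
    unfolding a_def by (subst Bochner_Integration.integral_diff[OF iA]) (auto simp: less_top[symmetric])
  also have "\<dots> = (\<integral>w. indicator A w * (demeaned M Y2 w - demeaned M Y1 w) \<partial>M)"
    by (intro Bochner_Integration.integral_cong) (auto simp: f_def c_def demeaned_def algebra_simps)
  finally show ?thesis
    unfolding A_def .
qed

text \<open>The function \<open>h\<close> records that the outcome change is determined by \<omega>,
  so a mechanism may select on it. Leaving \<omega> and \<open>h\<close> general serves both choices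
  of \<omega> in the theorem.\<close>

lemma parallel_trends_all_iff:
  fixes \<omega> :: "'a \<Rightarrow> 'b::second_countable_topology"
  assumes [measurable]: "\<omega> \<in> borel_measurable M" "\<nu> \<in> borel_measurable M"
    "h \<in> borel_measurable borel"
    and Y: "integrable M Y1" "integrable M Y2"
    and h: "\<And>w. Y2 w - Y1 w = h (\<omega> w)"
  shows "parallel_trends_all M Y1 Y2 \<omega> \<nu> \<longleftrightarrow> (AE w in M. demeaned M Y1 w = demeaned M Y2 w)"
proof -
  \<comment> \<open>\<open>D\<close> is already centred here, so selecting above-average changes
    means selecting \<open>0 < D\<close>.\<close>
  define D where "D = (\<lambda>w. demeaned M Y2 w - demeaned M Y1 w)"
  have D: "integrable M D" "expectation D = 0"
    using Y unfolding D_def demeaned_def by (simp_all add: prob_space)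
  have [measurable]: "D \<in> borel_measurable M"
    using D(1) by simp
  have pt: "parallel_trends M Y1 Y2 (\<lambda>w. g (\<omega> w, \<nu> w)) \<longleftrightarrow>
      (\<integral>w. indicator {w \<in> space M. g (\<omega> w, \<nu> w) = 1} w * D w \<partial>M) = 0"
    if g: "g \<in> selection_mechanisms M \<omega> \<nu>"
      and "\<P>(w in M. g (\<omega> w, \<nu> w) = 1) \<in> {0<..<1}" for g
  proof -
    have "{w \<in> space M. g (\<omega> w, \<nu> w) = i} \<in> events" if "i \<in> {0, 1}" for i
    proof -
      have "(\<lambda>w. (\<omega> w, \<nu> w)) -` {p. g p = i} \<inter> space M \<in> events"
        using sets_selection_mechanism[OF g that] by measurable
      then show ?thesis
        by (simp add: vimage_def Int_def conj_commute)
    qed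
    then show ?thesis
      unfolding D_def using that Y AE_selection_mechanism[OF g] by (intro parallel_trends_iff) auto
  qed
  show ?thesis
  proof
    assume all: "parallel_trends_all M Y1 Y2 \<omega> \<nu>"
    define c where "c = expectation Y2 - expectation Y1"
    define S where "S = rv_support M \<omega> \<times> rv_support M \<nu>"
    \<comment> \<open>The mechanism looks only at the first component; \<open>restrict\<close>
      supplies the required extensionality.\<close>
    define g :: "'b \<times> real \<Rightarrow> nat"
      where "g = restrict (\<lambda>p. if c < h (fst p) then 1 else 0) S"
    define A where "A = {w \<in> space M. g (\<omega> w, \<nu> w) = 1}"
    have Dh: "D w = h (\<omega> w) - c" for w
      using h[of w] by (simp add: D_def demeaned_def c_def)
    have "(\<lambda>p::'b \<times> real. if c < h (fst p) then 1 else 0::nat) \<in> measurable borel (count_space {0, 1})"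
      by (rule measurable_If) (auto simp: borel_prod[symmetric])
    from measurable_restrict_space1[OF this, of S]
    have "g \<in> measurable (restrict_space borel S) (count_space {0, 1})"
      by (rule measurable_cong[THEN iffD1, rotated]) (simp add: g_def space_restrict_space)
    then have g: "g \<in> selection_mechanisms M \<omega> \<nu>"
      unfolding selection_mechanisms_def S_def[symmetric] by (simp add: g_def)
    \<comment> \<open>Only almost surely: off \<open>S\<close> the value of \<open>g\<close> is
      \<open>undefined\<close>, which could be 1.\<close>
    have A: "AE w in M. w \<in> A \<longleftrightarrow> 0 < D w"
      using AE_in_rv_support[of \<omega>] AE_in_rv_support[of \<nu>] AE_space
      by (auto simp: A_def g_def S_def Dh)
    have "{p. g p = 1} \<in> sets borel"
      using sets_selection_mechanism[OF g] by simp
    then have "(\<lambda>w. (\<omega> w, \<nu> w)) -` {p. g p = 1} \<inter> space M \<in> events"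
      by measurable
    then have [measurable]: "A \<in> events"
      by (simp add: A_def vimage_def Int_def conj_commute)
    have "(\<integral>w. indicator A w * D w \<partial>M) = 0"
    proof -
      \<comment> \<open>Parallel trends says nothing about a degenerate group, so these cases are
        settled directly: the integral is over a null set, or it is the mean of \<open>D\<close>,
        which is 0.\<close>
      consider "prob A = 0" | "prob A = 1" | "prob A \<in> {0<..<1}"
        using prob_le_1[of A] measure_nonneg[of M A] by (metis greaterThanLessThan_iff less_le)
      then show ?thesis
      proof cases
        case 1
        then have "AE w in M. w \<notin> A"
          by (simp add: prob_eq_0)
        then show ?thesis
          by (intro integral_eq_zero_AE) auto
      next
        case 2
        then have "AE w in M. w \<in> A"
          by (simp add: prob_eq_1)
        then have "(\<integral>w. indicator A w * D w \<partial>M) = expectation D"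
          by (intro integral_cong_AE) auto
        then show ?thesis
          using D(2) by simp
      next
        case 3
        then show ?thesis
          using all g pt[OF g] unfolding parallel_trends_all_def A_def by auto
      qed
    qed
    \<comment> \<open>Restricting \<open>D\<close> to \<open>A\<close> leaves its positive part,
      whose zero integral forces \<open>D\<close> to be nonpositive almost surely; having mean zero,
      \<open>D\<close> then vanishes.\<close>
    moreover have "(\<integral>w. indicator A w * D w \<partial>M) = (\<integral>w. max 0 (D w) \<partial>M)"
      using A by (intro integral_cong_AE) (auto simp: indicator_def)
    ultimately have "AE w in M. max 0 (D w) = 0"
      using D(1) by (subst integral_nonneg_eq_0_iff_AE[symmetric]) auto
    then have "AE w in M. 0 \<le> - D w"
      by eventually_elim auto
    then have "AE w in M. - D w = 0"
      using D by (subst integral_nonneg_eq_0_iff_AE[symmetric]) auto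
    then show "AE w in M. demeaned M Y1 w = demeaned M Y2 w"
      by eventually_elim (simp add: D_def)
  next
    assume "AE w in M. demeaned M Y1 w = demeaned M Y2 w"
    then have "(\<integral>w. indicator A w * D w \<partial>M) = 0" for A
      unfolding D_def by (intro integral_eq_zero_AE) auto
    then show "parallel_trends_all M Y1 Y2 \<omega> \<nu>"
      using pt unfolding parallel_trends_all_def by blast
  qed
qed

end

theorem corollary3p2:
  fixes M :: "'w measure"
    and \<alpha> :: "'w \<Rightarrow> 'a::euclidean_space"
    and \<epsilon>1 :: "'w \<Rightarrow> 'e1::euclidean_space" and \<epsilon>2 :: "'w \<Rightarrow> 'e2::euclidean_space"
    and \<mu> :: "'w \<Rightarrow> 'm::euclidean_space"
    and \<eta>1 :: "'w \<Rightarrow> 'h1::euclidean_space" and \<eta>2 :: "'w \<Rightarrow> 'h2::euclidean_space"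
    and \<nu> :: "'w \<Rightarrow> real"
    and \<xi>1 :: "'a \<times> 'e1 \<Rightarrow> real" and \<xi>2 :: "'a \<times> 'e2 \<Rightarrow> real"
    and Y1 Y2 :: "'w \<Rightarrow> real"
    and \<omega> :: "'w \<Rightarrow> 'a \<times> 'e1 \<times> 'e2 \<times> 'm \<times> 'h1 \<times> 'h2"
    and \<omega>' :: "'w \<Rightarrow> 'a \<times> 'e1 \<times> 'e2"
  assumes "prob_space M"
    and "\<alpha> \<in> borel_measurable M" "\<epsilon>1 \<in> borel_measurable M" "\<epsilon>2 \<in> borel_measurable M"
    and "\<mu> \<in> borel_measurable M" "\<eta>1 \<in> borel_measurable M" "\<eta>2 \<in> borel_measurable M"
    and "\<nu> \<in> borel_measurable M"
    and "\<xi>1 \<in> borel_measurable borel" "\<xi>2 \<in> borel_measurable borel"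
    and "Y1 = (\<lambda>w. \<xi>1 (\<alpha> w, \<epsilon>1 w))" "Y2 = (\<lambda>w. \<xi>2 (\<alpha> w, \<epsilon>2 w))"
    and "integrable M Y1" "integrable M Y2"
    and "\<omega> = (\<lambda>w. (\<alpha> w, \<epsilon>1 w, \<epsilon>2 w, \<mu> w, \<eta>1 w, \<eta>2 w))"
    and "\<omega>' = (\<lambda>w. (\<alpha> w, \<epsilon>1 w, \<epsilon>2 w))"
    and "\<exists>c. \<P>(w in M. \<nu> w > c) \<in> {0<..<1}"
    and "rv_indep M \<nu> (\<lambda>w. (\<alpha> w, \<epsilon>1 w, \<epsilon>2 w, \<mu> w, \<eta>1 w, \<eta>2 w))"
  shows
    "(\<P>(w in M. cond_exp_given M \<omega> (\<lambda>w. demeaned M Y2 w - demeaned M Y1 w) w > 0) < 1 \<or>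
      \<P>(w in M. cond_exp_given M \<omega> (\<lambda>w. demeaned M Y2 w - demeaned M Y1 w) w < 0) < 1 \<longrightarrow>
        (parallel_trends_all M Y1 Y2 \<omega> \<nu> \<longleftrightarrow> (AE w in M. demeaned M Y1 w = demeaned M Y2 w)))
     \<and>
     (\<P>(w in M. cond_exp_given M \<omega>' (\<lambda>w. demeaned M Y2 w - demeaned M Y1 w) w > 0) < 1 \<or>
      \<P>(w in M. cond_exp_given M \<omega>' (\<lambda>w. demeaned M Y2 w - demeaned M Y1 w) w < 0) < 1 \<longrightarrow>
        (parallel_trends_all M Y1 Y2 \<omega>' \<nu> \<longleftrightarrow> (AE w in M. demeaned M Y1 w = demeaned M Y2 w)))"
proof -
  interpret prob_space M by fact
  have \<omega>: "\<omega> \<in> borel_measurable M" "\<omega>' \<in> borel_measurable M"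
    using assms(2-7) unfolding assms(15,16) by (auto intro!: borel_measurable_Pair)
  have "parallel_trends_all M Y1 Y2 \<omega> \<nu> \<longleftrightarrow> (AE w in M. demeaned M Y1 w = demeaned M Y2 w)"
  proof (rule parallel_trends_all_iff)
    \<comment> \<open>The projections pick \<alpha>, \<epsilon>1 and \<epsilon>2 out of the nested
      pairs; being continuous, they keep the composition Borel.\<close>
    show "(\<lambda>x. \<xi>2 (fst x, fst (snd (snd x))) - \<xi>1 (fst x, fst (snd x))) \<in> borel_measurable borel"
      by (intro borel_measurable_diff measurable_compose[OF _ assms(9)]
          measurable_compose[OF _ assms(10)] borel_measurable_continuous_onI continuous_intros)
    show "Y2 w - Y1 w = \<xi>2 (fst (\<omega> w), fst (snd (snd (\<omega> w)))) - \<xi>1 (fst (\<omega> w), fst (snd (\<omega> w)))" for w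
      by (simp add: assms(11,12,15))
  qed (fact assms \<omega>)+
  moreover have "parallel_trends_all M Y1 Y2 \<omega>' \<nu> \<longleftrightarrow> (AE w in M. demeaned M Y1 w = demeaned M Y2 w)"
  proof (rule parallel_trends_all_iff)
    \<comment> \<open>In the triple, \<epsilon>2 is the last component, hence
      \<open>snd (snd x)\<close> without a further \<open>fst\<close>.\<close>
    show "(\<lambda>x. \<xi>2 (fst x, snd (snd x)) - \<xi>1 (fst x, fst (snd x))) \<in> borel_measurable borel"
      by (intro borel_measurable_diff measurable_compose[OF _ assms(9)]
          measurable_compose[OF _ assms(10)] borel_measurable_continuous_onI continuous_intros)
    show "Y2 w - Y1 w = \<xi>2 (fst (\<omega>' w), snd (snd (\<omega>' w))) - \<xi>1 (fst (\<omega>' w), fst (snd (\<omega>' w)))" for w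
      by (simp add: assms(11,12,16))
  qed (fact assms \<omega>)+
  ultimately show ?thesis
    by blast
qed

end
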